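(* Let $\mathcal{H}$ be a complex Hilbert space and let $A\in\mathcal{B}(\mathcal{H})$. Then \[\frac{\|A\|}{2}\le\frac12\left(\left\|\mathfrak{R}A\right\|+\left\|\mathfrak{I}A\right\|\right)\le\frac23\int_0^{\frac12}\left[\omega_t(A)+\omega\left((1-2t)A-A^*\right)\right]dt\le\omega(A).\]
   Context: $\mathcal{B}(\mathcal{H})$ is the $C^*$-algebra of bounded linear operators on the complex Hilbert space $\mathcal{H}$, with operator norm $\|\cdot\|$. $\mathfrak{R}A=\frac{A+A^*}{2}$ and $\mathfrak{I}A=\frac{A-A^*}{2\mathrm{i}}$. The numerical radius is $\omega(A)=\sup_{\|x\|=1}|\langle Ax,x\rangle|$. For $0\le t\le 1$, the $t$-weighted numerical radius of $A$ is $\omega_t(A)=\omega\left((1-2t)A^*+A\right)$. *)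

theory Defs
  imports "HOL-Analysis.Analysis"
begin

class complex_hilbert_space = banach +
  fixes scaleC :: "complex \<Rightarrow> 'a \<Rightarrow> 'a"  (infixr "*\<^sub>C" 75)
    and cinner :: "'a \<Rightarrow> 'a \<Rightarrow> complex"
  assumes scaleC_add_right: "a *\<^sub>C (x + y) = a *\<^sub>C x + a *\<^sub>C y"
    and scaleC_add_left: "(a + b) *\<^sub>C x = a *\<^sub>C x + b *\<^sub>C x"
    and scaleC_scaleC: "a *\<^sub>C (b *\<^sub>C x) = (a * b) *\<^sub>C x"
    and scaleC_of_real: "complex_of_real r *\<^sub>C x = r *\<^sub>R x"
    and cinner_add_left: "cinner (x + y) z = cinner x z + cinner y z"
    and cinner_scaleC_left: "cinner (a *\<^sub>C x) y = a * cinner x y"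
    and cinner_commute: "cinner x y = cnj (cinner y x)"
    \<comment> \<open>The norm is the one induced by the inner product; together with the norm axioms
      this also makes the (conjugate-symmetric) form positive definite. Completeness
      is inherited from the class of Banach spaces.\<close>
    and cinner_self: "cinner x x = complex_of_real ((norm x)\<^sup>2)"

instantiation complex :: complex_hilbert_space
begin

definition scaleC_complex :: "complex \<Rightarrow> complex \<Rightarrow> complex"
  where "scaleC_complex a x = a * x"

definition cinner_complex :: "complex \<Rightarrow> complex \<Rightarrow> complex"
  where "cinner_complex x y = x * cnj y"

instance
  by standard
    (simp_all add: scaleC_complex_def cinner_complex_def algebra_simps scaleR_conv_of_real
      complex_norm_square del: of_real_power)

end

definition bounded_clinear ::
    "('a::complex_hilbert_space \<Rightarrow> 'b::complex_hilbert_space) \<Rightarrow> bool"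
  where "bounded_clinear A \<longleftrightarrow> bounded_linear A \<and> (\<forall>c x. A (c *\<^sub>C x) = c *\<^sub>C A x)"

text \<open>For bounded \<open>A\<close> the operator described here exists and is unique by the Riesz
  representation theorem.\<close>

definition adj :: "('a::complex_hilbert_space \<Rightarrow> 'a) \<Rightarrow> 'a \<Rightarrow> 'a"
  where "adj A = (SOME B. \<forall>x y. cinner (A x) y = cinner x (B y))"

definition re_part :: "('a::complex_hilbert_space \<Rightarrow> 'a) \<Rightarrow> 'a \<Rightarrow> 'a"
  where "re_part A = (\<lambda>x. (1 / 2) *\<^sub>C (A x + adj A x))"

definition im_part :: "('a::complex_hilbert_space \<Rightarrow> 'a) \<Rightarrow> 'a \<Rightarrow> 'a"
  where "im_part A = (\<lambda>x. (1 / (2 * \<i>)) *\<^sub>C (A x - adj A x))"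

text \<open>The supremum is taken in the nonnegative reals. Inserting \<open>0\<close> only matters on the zero
  space, which has no unit vectors: there the value is \<open>0\<close>, whereas \<open>Sup {}\<close> is an
  unspecified real.\<close>

definition numerical_radius :: "('a::complex_hilbert_space \<Rightarrow> 'a) \<Rightarrow> real"
  where "numerical_radius A = Sup (insert 0 {cmod (cinner (A x) x) | x. norm x = 1})"

definition weighted_numerical_radius :: "real \<Rightarrow> ('a::complex_hilbert_space \<Rightarrow> 'a) \<Rightarrow> real"
  where "weighted_numerical_radius t A =
    numerical_radius (\<lambda>x. complex_of_real (1 - 2 * t) *\<^sub>C adj A x + A x)"

end

theory Submission
  imports Defs
begin

text \<open>Write \<open>A = R + iJ\<close> with \<open>R\<close>, \<open>J\<close> self-adjoint and \<open>s = 1 - 2t\<close>. The quadratic form of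
  \<open>sA\<^sup>* + A\<close> is \<open>(1 + s) \<langle>Rx,x\<rangle> + i (1 - s) \<langle>Jx,x\<rangle>\<close> and that of \<open>sA - A\<^sup>*\<close> is
  \<open>(s - 1) \<langle>Rx,x\<rangle> + i (1 + s) \<langle>Jx,x\<rangle>\<close>. Their numerical radii are therefore at least
  \<open>(1 + s) \<parallel>R\<parallel>\<close> and \<open>(1 + s) \<parallel>J\<parallel>\<close>, because the norm of a self-adjoint operator is its numerical
  radius, and at most \<open>(1 + s) \<omega>(A)\<close>. Since \<open>1 + s = 2 - 2t\<close> has integral \<open>3/4\<close> over
  \<open>[0, 1/2]\<close>, integrating gives the two right-hand inequalities.\<close>

section \<open>Complex inner products\<close>

lemma cinner_add_right: "cinner x (y + z) = cinner x y + cinner x (z::'a::complex_hilbert_space)"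
  by (metis cinner_add_left cinner_commute complex_cnj_add)

lemma cinner_scaleC_right: "cinner x (a *\<^sub>C y) = cnj a * cinner x (y::'a::complex_hilbert_space)"
  by (metis cinner_scaleC_left cinner_commute complex_cnj_mult)

lemma cinner_scaleR_left: "cinner (r *\<^sub>R x) y = of_real r * cinner x (y::'a::complex_hilbert_space)"
  by (metis cinner_scaleC_left scaleC_of_real)

lemma cinner_scaleR_right: "cinner x (r *\<^sub>R y) = of_real r * cinner x (y::'a::complex_hilbert_space)"
  by (metis cinner_scaleC_right scaleC_of_real complex_cnj_complex_of_real)

lemma cinner_minus_left: "cinner (- x) y = - cinner x (y::'a::complex_hilbert_space)"
  using cinner_scaleR_left[of "-1" x y] by simp

lemma cinner_minus_right: "cinner x (- y) = - cinner x (y::'a::complex_hilbert_space)"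
  using cinner_scaleR_right[of x "-1" y] by simp

lemma cinner_diff_left: "cinner (x - y) z = cinner x z - cinner y (z::'a::complex_hilbert_space)"
  using cinner_add_left[of x "-y" z] by (simp add: cinner_minus_left)

lemma cinner_diff_right: "cinner x (y - z) = cinner x y - cinner x (z::'a::complex_hilbert_space)"
  using cinner_add_right[of x y "-z"] by (simp add: cinner_minus_right)

lemma cinner_zero_left [simp]: "cinner 0 (y::'a::complex_hilbert_space) = 0"
  using cinner_diff_left[of y y y] by simp

lemma cinner_zero_right [simp]: "cinner (y::'a::complex_hilbert_space) 0 = 0"
  using cinner_diff_right[of y y y] by simp

lemmas cinner_simps =
  cinner_add_left cinner_add_right cinner_diff_left cinner_diff_right
  cinner_scaleC_left cinner_scaleC_right cinner_scaleR_left cinner_scaleR_right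

lemma power2_norm_eq_cinner: "(norm x)\<^sup>2 = Re (cinner x (x::'a::complex_hilbert_space))"
  by (simp add: cinner_self)

lemma Re_cinner_commute: "Re (cinner x y) = Re (cinner y (x::'a::complex_hilbert_space))"
  by (subst cinner_commute) simp

lemma cinner_ext:
  assumes "\<And>x. cinner x y = cinner x (z::'a::complex_hilbert_space)"
  shows "y = z"
proof -
  have "cinner (y - z) (y - z) = 0"
    using assms[of "y - z"] by (simp add: cinner_diff_right)
  then show ?thesis by (simp add: cinner_self)
qed

lemma norm_scaleC: "norm (a *\<^sub>C x) = cmod a * norm (x::'a::complex_hilbert_space)"
proof -
  have "cinner (a *\<^sub>C x) (a *\<^sub>C x) = of_real ((cmod a * norm x)\<^sup>2)"
    unfolding cinner_scaleC_left cinner_scaleC_right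
    using complex_norm_square[of a]
    by (simp add: cinner_self power_mult_distrib mult.commute)
  then have "(norm (a *\<^sub>C x))\<^sup>2 = (cmod a * norm x)\<^sup>2"
    unfolding cinner_self of_real_eq_iff .
  then show ?thesis by simp
qed

lemma bounded_linear_scaleC: "bounded_linear (\<lambda>x::'a::complex_hilbert_space. c *\<^sub>C x)"
proof (rule bounded_linear_intro[where K = "cmod c"])
  show "c *\<^sub>C (r *\<^sub>R x) = r *\<^sub>R (c *\<^sub>C x)" for r and x :: 'a
    unfolding scaleC_of_real[symmetric] scaleC_scaleC by (simp add: mult.commute)
qed (simp_all add: scaleC_add_right norm_scaleC)

text \<open>The triangle inequality comes with the norm here, so Cauchy-Schwarz for real parts is
  read off from it by squaring and expanding.\<close>

lemma Re_cinner_le: "Re (cinner x y) \<le> norm x * norm (y::'a::complex_hilbert_space)"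
proof -
  have "(norm (x + y))\<^sup>2 \<le> (norm x + norm y)\<^sup>2"
    by (simp add: norm_triangle_ineq power_mono)
  then show ?thesis
    using Re_cinner_commute[of x y]
    by (simp add: power2_norm_eq_cinner power2_sum cinner_simps)
qed

lemma cmod_cinner_le: "cmod (cinner x y) \<le> norm x * norm (y::'a::complex_hilbert_space)"
proof (cases "cinner x y = 0")
  case False
  \<comment> \<open>The unimodular factor \<open>u\<close> rotates \<open>cinner x y\<close> onto
    the nonnegative real axis, which reduces the claim to the real-part bound.\<close>
  define u where "u = cnj (cinner x y) / cmod (cinner x y)"
  have "cinner (u *\<^sub>C x) y = cmod (cinner x y)"
    using False complex_norm_square[of "cinner x y"]
    by (simp add: u_def cinner_simps field_simps power2_eq_square)
  moreover have "cmod u = 1"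
    using False by (simp add: u_def norm_divide)
  ultimately show ?thesis
    using Re_cinner_le[of "u *\<^sub>C x" y] by (simp add: norm_scaleC)
qed simp

lemma parallelogram:
  "(norm (x + y))\<^sup>2 + (norm (x - y))\<^sup>2 = 2 * (norm x)\<^sup>2 + 2 * (norm (y::'a::complex_hilbert_space))\<^sup>2"
  by (simp add: power2_norm_eq_cinner cinner_simps)

section \<open>Riesz representation and the adjoint\<close>

text \<open>The representing vector minimises \<open>\<parallel>x\<parallel>\<^sup>2 - 2 f x\<close>: by the parallelogram law every
  minimising sequence is Cauchy, and the first-order condition at the limit is the claim.\<close>

lemma riesz_real:
  fixes f :: "'a::complex_hilbert_space \<Rightarrow> real"
  assumes "bounded_linear f"
  obtains z where "\<And>x. f x = Re (cinner x z)"
proof -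
  interpret f: bounded_linear f by fact
  obtain K where K: "\<And>x. norm (f x) \<le> norm x * K"
    using f.bounded by blast
  define J where "J = (\<lambda>x. (norm x)\<^sup>2 - 2 * f x)"
  \<comment> \<open>Completing the square in \<open>norm x\<close> bounds \<open>J\<close> from
    below, so its infimum \<open>m\<close> is a genuine one.\<close>
  have J_lower: "J x \<ge> - K\<^sup>2" for x
  proof -
    have "f x \<le> norm x * K" using K[of x] by simp
    moreover have "0 \<le> (norm x - K)\<^sup>2" by simp
    ultimately show ?thesis unfolding J_def power2_diff by linarith
  qed
  define m where "m = Inf (range J)"
  have bdd: "bdd_below (range J)" using J_lower by (auto intro!: bdd_belowI)
  have m_le: "m \<le> J x" for x
    unfolding m_def by (rule cInf_lower[OF _ bdd]) simp
  have "\<exists>x. J x < m + inverse (Suc n)" for n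
    using cInf_less_iff[OF _ bdd, of "m + inverse (Suc n)"] by (auto simp: m_def[symmetric])
  then obtain X where X: "\<And>n. J (X n) < m + inverse (real (Suc n))" by metis
  \<comment> \<open>The parallelogram law rewrites the left side as \<open>2 * J x + 2 * J y\<close>
    minus four times \<open>J\<close> at the midpoint, and that value is at least
    \<open>m\<close>.\<close>
  have gap: "(norm (x - y))\<^sup>2 \<le> 2 * J x + 2 * J y - 4 * m" for x y
  proof -
    have "4 * J ((1/2) *\<^sub>R (x + y)) = (norm (x + y))\<^sup>2 - 4 * f x - 4 * f y"
      by (simp add: J_def f.scaleR f.add power_divide add_divide_distrib)
    then show ?thesis
      using m_le[of "(1/2) *\<^sub>R (x + y)"] parallelogram[of x y]
        fun_cong[OF J_def, of x] fun_cong[OF J_def, of y]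
      by simp
  qed
  have J_lim: "(\<lambda>n. J (X n)) \<longlonglongrightarrow> m"
  proof (rule tendsto_sandwich[OF _ _ tendsto_const])
    show "(\<lambda>n. m + inverse (real (Suc n))) \<longlonglongrightarrow> m"
      using tendsto_add[OF tendsto_const LIMSEQ_inverse_real_of_nat, of m] by simp
  qed (use m_le X in \<open>auto intro!: always_eventually less_imp_le\<close>)
  have "Cauchy X"
  proof (rule metric_CauchyI)
    fix e :: real assume "e > 0"
    \<comment> \<open>With both values of \<open>J\<close> within \<open>e\<^sup>2 / 4\<close> of
      \<open>m\<close>, \<open>gap\<close> bounds the squared distance by
      \<open>4 * (e\<^sup>2 / 4)\<close>.\<close>
    then have "\<forall>\<^sub>F n in sequentially. J (X n) < m + e\<^sup>2 / 4"
      by (intro order_tendstoD(2)[OF J_lim]) simp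
    then obtain N where N: "\<And>n. n \<ge> N \<Longrightarrow> J (X n) < m + e\<^sup>2 / 4"
      by (auto simp: eventually_sequentially)
    have "dist (X i) (X j) < e" if "i \<ge> N" "j \<ge> N" for i j
    proof (rule power2_less_imp_less)
      show "(dist (X i) (X j))\<^sup>2 < e\<^sup>2"
        using gap[of "X i" "X j"] N[OF that(1)] N[OF that(2)] unfolding dist_norm by linarith
    qed (use \<open>e > 0\<close> in simp)
    then show "\<exists>M. \<forall>i\<ge>M. \<forall>j\<ge>M. dist (X i) (X j) < e" by blast
  qed
  then obtain z where z: "X \<longlonglongrightarrow> z"
    using Cauchy_convergent_iff convergent_def by blast
  have "(\<lambda>n. J (X n)) \<longlonglongrightarrow> J z"
    unfolding J_def by (intro tendsto_intros f.tendsto z)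
  then have Jz: "J z = m"
    using J_lim LIMSEQ_unique by blast
  have le: "f h \<le> Re (cinner h z)" for h
  proof (rule ccontr)
    assume not_le: "\<not> f h \<le> Re (cinner h z)"
    define d where "d = f h - Re (cinner h z)"
    have d: "d > 0" using not_le by (simp add: d_def)
    \<comment> \<open>Moving from \<open>z\<close> by \<open>t *\<^sub>R h\<close> changes
      \<open>J\<close> by \<open>- 2 * t * d + t\<^sup>2 * (norm h)\<^sup>2\<close>, which is
      negative for this \<open>t\<close> and contradicts minimality. The added \<open>1\<close>
      keeps the denominator positive for every \<open>h\<close>.\<close>
    define t where "t = d / ((norm h)\<^sup>2 + 1)"
    have n1: "(norm h)\<^sup>2 + 1 > 0" by (simp add: add_nonneg_pos)
    have t: "t > 0" using d n1 by (simp add: t_def)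
    have "J (z + t *\<^sub>R h) = J z - 2 * t * d + t\<^sup>2 * (norm h)\<^sup>2"
      using Re_cinner_commute[of z h]
      unfolding J_def d_def power2_norm_eq_cinner
      by (simp add: cinner_simps f.add f.scaleR algebra_simps power2_eq_square)
    then have "2 * t * d \<le> t\<^sup>2 * (norm h)\<^sup>2"
      using m_le[of "z + t *\<^sub>R h"] Jz by linarith
    then have "2 * d \<le> t * (norm h)\<^sup>2"
      using t by (simp add: power2_eq_square mult.assoc mult.left_commute[of 2])
    also have "\<dots> \<le> t * ((norm h)\<^sup>2 + 1)" using t by simp
    also have "\<dots> = d" using n1 by (simp add: t_def)
    finally show False using d by simp
  qed
  \<comment> \<open>Both sides are odd in \<open>h\<close>, so the inequality at \<open>- h\<close>
    is the reverse one.\<close>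
  have "f h = Re (cinner h z)" for h
    using le[of h] le[of "- h"] by (simp add: f.neg cinner_minus_left)
  then show ?thesis by (rule that)
qed

text \<open>A complex-linear functional is determined by its real part, since
  \<open>Im (f x) = - Re (f (\<i> *\<^sub>C x))\<close>. The vector representing \<open>Re f\<close>
  therefore represents \<open>f\<close>.\<close>

lemma riesz:
  fixes f :: "'a::complex_hilbert_space \<Rightarrow> complex"
  assumes f: "bounded_linear f" and scaleC: "\<And>c x. f (c *\<^sub>C x) = c * f x"
  obtains z where "\<And>x. f x = cinner x z"
proof -
  obtain z where z: "\<And>x. Re (f x) = Re (cinner x z)"
    using riesz_real[OF bounded_linear_compose[OF bounded_linear_Re f]] by auto
  have "f x = cinner x z" for x
    using z[of x] z[of "\<i> *\<^sub>C x"] by (simp add: complex_eq_iff scaleC cinner_simps)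
  then show ?thesis by (rule that)
qed

lemma bounded_linear_cinner_left: "bounded_linear (\<lambda>x. cinner x (y::'a::complex_hilbert_space))"
  by (rule bounded_linear_intro[where K = "norm y"])
    (simp_all add: cinner_simps scaleR_conv_of_real cmod_cinner_le)

text \<open>Riesz applied to \<open>\<lambda>x. cinner (A x) y\<close> for each \<open>y\<close>
  gives a witness for the choice in \<open>adj\<close>, so the chosen operator has the adjoint
  property.\<close>

lemma cinner_adj:
  fixes A :: "'a::complex_hilbert_space \<Rightarrow> 'a"
  assumes "bounded_clinear A"
  shows "cinner (A x) y = cinner x (adj A y)"
proof -
  have "\<exists>z. \<forall>x. cinner (A x) y = cinner x z" for y
  proof (rule riesz)
    show "bounded_linear (\<lambda>x. cinner (A x) y)"
      using assms bounded_linear_compose[OF bounded_linear_cinner_left]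
      by (auto simp: bounded_clinear_def)
    show "cinner (A (c *\<^sub>C x)) y = c * cinner (A x) y" for c x
      using assms by (simp add: bounded_clinear_def cinner_simps)
  qed blast
  then have "\<exists>B. \<forall>x y. cinner (A x) y = cinner x (B y)"
    by metis
  from someI_ex[OF this] show ?thesis
    unfolding adj_def by blast
qed

lemma cinner_adj_left:
  assumes "bounded_clinear A"
  shows "cinner (adj A x) y = cinner x (A y)"
  by (metis assms cinner_adj cinner_commute)

text \<open>Linearity follows because a vector is determined by its inner products. For the bound,
  \<open>(norm (adj A x))\<^sup>2\<close> is the inner product of \<open>A (adj A x)\<close> with
  \<open>x\<close>; Cauchy-Schwarz and cancelling one factor finish.\<close>

lemma bounded_linear_adj:
  fixes A :: "'a::complex_hilbert_space \<Rightarrow> 'a"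
  assumes A: "bounded_clinear A"
  shows "bounded_linear (adj A)"
proof (rule bounded_linear_intro[where K = "onorm A"])
  show "adj A (x + y) = adj A x + adj A y" for x y
    by (rule cinner_ext) (simp add: cinner_adj[OF A, symmetric] cinner_simps)
  show "adj A (r *\<^sub>R x) = r *\<^sub>R adj A x" for r x
    by (rule cinner_ext) (simp add: cinner_adj[OF A, symmetric] cinner_simps)
  show "norm (adj A x) \<le> norm x * onorm A" for x
  proof (cases "adj A x = 0")
    case True
    then show ?thesis
      using A by (simp add: bounded_clinear_def onorm_pos_le)
  next
    case False
    have "(norm (adj A x))\<^sup>2 = Re (cinner (A (adj A x)) x)"
      by (simp add: power2_norm_eq_cinner cinner_adj[OF A])
    also have "\<dots> \<le> norm (A (adj A x)) * norm x"
      by (rule Re_cinner_le)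
    also have "\<dots> \<le> (onorm A * norm (adj A x)) * norm x"
      using A by (intro mult_right_mono onorm) (auto simp: bounded_clinear_def)
    finally show ?thesis
      using False by (simp add: power2_eq_square mult.assoc mult.commute mult.left_commute)
  qed
qed

section \<open>The numerical radius\<close>

lemma numerical_radius_upper:
  fixes A :: "'a::complex_hilbert_space \<Rightarrow> 'a"
  assumes "bounded_linear A" "norm x = 1"
  shows "cmod (cinner (A x) x) \<le> numerical_radius A"
  unfolding numerical_radius_def
proof (rule cSup_upper)
  have "cmod (cinner (A y) y) \<le> onorm A" if "norm y = 1" for y
    using cmod_cinner_le[of "A y" y] onorm[OF assms(1), of y] that by simp
  then show "bdd_above (insert 0 {cmod (cinner (A x) x) |x. norm x = 1})"
    by (auto intro!: bdd_aboveI)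
qed (use assms(2) in auto)

text \<open>The assumption \<open>0 \<le> M\<close> covers the \<open>0\<close> inserted into the
  supremum.\<close>

lemma numerical_radius_least:
  fixes A :: "'a::complex_hilbert_space \<Rightarrow> 'a"
  assumes "\<And>x. norm x = 1 \<Longrightarrow> cmod (cinner (A x) x) \<le> M" "0 \<le> M"
  shows "numerical_radius A \<le> M"
  unfolding numerical_radius_def using assms by (intro cSup_least) auto

lemma numerical_radius_nonneg:
  fixes A :: "'a::complex_hilbert_space \<Rightarrow> 'a"
  assumes "bounded_linear A"
  shows "0 \<le> numerical_radius A"
proof (cases "\<exists>x::'a. norm x = 1")
  case True
  then show ?thesis
    using numerical_radius_upper[OF assms] norm_ge_zero order_trans by blast
next
  case False
  then have "{cmod (cinner (A x) x) |x. norm x = 1} = {}" by blast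
  then show ?thesis by (simp add: numerical_radius_def)
qed

lemma cmod_cinner_le_numerical_radius:
  fixes A :: "'a::complex_hilbert_space \<Rightarrow> 'a"
  assumes A: "bounded_linear A"
  shows "cmod (cinner (A x) x) \<le> numerical_radius A * (norm x)\<^sup>2"
proof (cases "x = 0")
  case False
  define u where "u = (1 / norm x) *\<^sub>R x"
  have x: "x = norm x *\<^sub>R u" and u: "norm u = 1"
    using False by (simp_all add: u_def)
  have "cinner (A x) x = of_real ((norm x)\<^sup>2) * cinner (A u) u"
    by (subst (1 2) x)
      (simp add: linear_simps(5)[OF A] cinner_simps power2_eq_square)
  then have "cmod (cinner (A x) x) = (norm x)\<^sup>2 * cmod (cinner (A u) u)"
    by (simp add: norm_mult norm_power)
  then show ?thesis
    using numerical_radius_upper[OF A u] by (simp add: mult.commute[of "(norm x)\<^sup>2"] mult_right_mono)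
qed simp

text \<open>For self-adjoint \<open>S\<close>, polarization expresses
  \<open>Re (cinner (S x) y)\<close> through the quadratic form at \<open>x + y\<close> and
  \<open>x - y\<close>; the parallelogram law then turns the bounds on these two values into
  \<open>polar\<close>.\<close>

lemma onorm_le_numerical_radius:
  fixes S :: "'a::complex_hilbert_space \<Rightarrow> 'a"
  assumes S: "bounded_linear S" and self_adjoint: "\<And>x y. cinner (S x) y = cinner x (S y)"
  shows "onorm S \<le> numerical_radius S"
proof (rule onorm_bound[OF numerical_radius_nonneg[OF S]])
  fix x
  interpret S: bounded_linear S by fact
  let ?w = "numerical_radius S"
  have polar: "2 * Re (cinner (S x) y) \<le> ?w * ((norm x)\<^sup>2 + (norm y)\<^sup>2)" for x y
  proof -
    have "4 * Re (cinner (S x) y) = Re (cinner (S (x + y)) (x + y)) - Re (cinner (S (x - y)) (x - y))"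
      using Re_cinner_commute[of "S y" x]
      by (simp add: S.add S.diff cinner_simps self_adjoint[of x y])
    also have "\<dots> \<le> ?w * (norm (x + y))\<^sup>2 + ?w * (norm (x - y))\<^sup>2"
      using cmod_cinner_le_numerical_radius[OF S, of "x + y"]
        cmod_cinner_le_numerical_radius[OF S, of "x - y"]
        abs_Re_le_cmod[of "cinner (S (x + y)) (x + y)"]
        abs_Re_le_cmod[of "cinner (S (x - y)) (x - y)"]
      by linarith
    also have "\<dots> = 2 * (?w * ((norm x)\<^sup>2 + (norm y)\<^sup>2))"
      unfolding distrib_left[symmetric] parallelogram by simp
    finally show ?thesis by simp
  qed
  show "norm (S x) \<le> ?w * norm x"
  proof (cases "S x = 0 \<or> x = 0")
    case True
    then show ?thesis
      using numerical_radius_nonneg[OF S] by (auto simp: S.zero)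
  next
    case False
    \<comment> \<open>This \<open>y\<close> points along \<open>S x\<close>, which makes the inner
      product maximal, and has the norm of \<open>x\<close>, which balances the two squares in
      \<open>polar\<close>.\<close>
    define y where "y = (norm x / norm (S x)) *\<^sub>R S x"
    have "norm y = norm x" using False by (simp add: y_def)
    moreover have "Re (cinner (S x) y) = norm x * norm (S x)"
      using False by (simp add: y_def cinner_simps cinner_self power2_eq_square)
    ultimately have "2 * (norm x * norm (S x)) \<le> ?w * (2 * (norm x)\<^sup>2)"
      using polar[of x y] by simp
    then show ?thesis
      using False by (simp add: power2_eq_square mult.assoc mult.left_commute)
  qed
qed

section \<open>Operator pencils with a real weight\<close>

lemma bounded_linear_scaleC_comp:
  fixes A :: "'a::complex_hilbert_space \<Rightarrow> 'a"
  assumes "bounded_linear A"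
  shows "bounded_linear (\<lambda>x. c *\<^sub>C A x)"
  using bounded_linear_compose[OF bounded_linear_scaleC assms] .

text \<open>This makes the integrand integrable. Changing \<open>s\<close> to \<open>r\<close>
  perturbs the quadratic form at a unit vector by at most
  \<open>\<bar>s - r\<bar> * numerical_radius B\<close>, so the function is Lipschitz.\<close>

lemma continuous_on_numerical_radius_pencil:
  fixes A B :: "'a::complex_hilbert_space \<Rightarrow> 'a"
  assumes A: "bounded_linear A" and B: "bounded_linear B"
  shows "continuous_on S (\<lambda>s::real. numerical_radius (\<lambda>x. complex_of_real s *\<^sub>C B x + A x))"
proof -
  let ?T = "\<lambda>(s::real) x. complex_of_real s *\<^sub>C B x + A x"
  have T: "bounded_linear (?T s)" for s
    by (intro bounded_linear_add bounded_linear_scaleC_comp A B)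
  have le: "numerical_radius (?T s) \<le> numerical_radius (?T r) + numerical_radius B * \<bar>s - r\<bar>" for s r
  proof (rule numerical_radius_least)
    fix x :: 'a assume x: "norm x = 1"
    have "cinner (?T s x) x = cinner (?T r x) x + of_real (s - r) * cinner (B x) x"
      by (simp add: cinner_simps algebra_simps)
    then have "cmod (cinner (?T s x) x) \<le> cmod (cinner (?T r x) x) + \<bar>s - r\<bar> * cmod (cinner (B x) x)"
      by (metis norm_triangle_ineq norm_mult norm_of_real)
    also have "\<dots> \<le> numerical_radius (?T r) + \<bar>s - r\<bar> * numerical_radius B"
      by (intro add_mono mult_left_mono numerical_radius_upper T B x) simp
    finally show "cmod (cinner (?T s x) x) \<le> numerical_radius (?T r) + numerical_radius B * \<bar>s - r\<bar>"
      by (simp add: mult.commute)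
  qed (simp add: numerical_radius_nonneg T B)
  have "(numerical_radius B)-lipschitz_on S (\<lambda>s. numerical_radius (?T s))"
  proof (rule lipschitz_onI)
    show "dist (numerical_radius (?T s)) (numerical_radius (?T r)) \<le> numerical_radius B * dist s r" for s r
      using le[of s r] le[of r s] by (simp add: dist_real_def abs_minus_commute abs_le_iff)
  qed (rule numerical_radius_nonneg[OF B])
  then show ?thesis by (rule lipschitz_on_continuous_on)
qed

text \<open>To be used with \<open>q = cinner (A x) x\<close>, where the two expressions are the
  quadratic forms of the pencils. One scales the real part of \<open>q\<close> by
  \<open>1 + s\<close>, the other the imaginary part; the upper bounds are triangle
  inequalities.\<close>

lemma cmod_pencil_bounds:
  fixes q :: complex and s :: real
  assumes "0 \<le> s" "s \<le> 1"
  shows "(1 + s) * \<bar>Re q\<bar> \<le> cmod (s * cnj q + q)" "cmod (s * cnj q + q) \<le> (1 + s) * cmod q"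
    and "(1 + s) * \<bar>Im q\<bar> \<le> cmod (s * q - cnj q)" "cmod (s * q - cnj q) \<le> (1 + s) * cmod q"
proof -
  have "Re (s * cnj q + q) = (1 + s) * Re q" "Im (s * q - cnj q) = (1 + s) * Im q"
    by (simp_all add: algebra_simps)
  then show "(1 + s) * \<bar>Re q\<bar> \<le> cmod (s * cnj q + q)" "(1 + s) * \<bar>Im q\<bar> \<le> cmod (s * q - cnj q)"
    using abs_Re_le_cmod[of "s * cnj q + q"] abs_Im_le_cmod[of "s * q - cnj q"] assms
    by (simp_all add: abs_mult)
  show "cmod (s * cnj q + q) \<le> (1 + s) * cmod q"
    using norm_triangle_ineq[of "s * cnj q" q] assms by (simp add: norm_mult algebra_simps)
  show "cmod (s * q - cnj q) \<le> (1 + s) * cmod q"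
    using norm_triangle_ineq4[of "s * q" "cnj q"] assms by (simp add: norm_mult algebra_simps)
qed

section \<open>Pencil bounds for the Cartesian parts and their integration\<close>

theorem proposition2p3:
  fixes A :: "'a::complex_hilbert_space \<Rightarrow> 'a"
  assumes "bounded_clinear A"
  shows "onorm A / 2 \<le> 1 / 2 * (onorm (re_part A) + onorm (im_part A))
    \<and> 1 / 2 * (onorm (re_part A) + onorm (im_part A))
        \<le> 2 / 3 * integral {0..1/2} (\<lambda>t. weighted_numerical_radius t A
            + numerical_radius (\<lambda>x. complex_of_real (1 - 2 * t) *\<^sub>C A x - adj A x))
    \<and> 2 / 3 * integral {0..1/2} (\<lambda>t. weighted_numerical_radius t A
            + numerical_radius (\<lambda>x. complex_of_real (1 - 2 * t) *\<^sub>C A x - adj A x))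
        \<le> numerical_radius A"
proof -
  have A: "bounded_linear A"
    using assms by (simp add: bounded_clinear_def)
  note adj = bounded_linear_adj[OF assms]
  have R: "bounded_linear (re_part A)" and J: "bounded_linear (im_part A)"
    unfolding re_part_def im_part_def
    by (intro bounded_linear_scaleC_comp bounded_linear_add bounded_linear_sub A adj)+
  have R_sa: "cinner (re_part A x) y = cinner x (re_part A y)" for x y
    by (simp add: re_part_def cinner_simps cinner_adj[OF assms] cinner_adj_left[OF assms])
  have J_sa: "cinner (im_part A x) y = cinner x (im_part A y)" for x y
    by (simp add: im_part_def cinner_simps cinner_adj[OF assms] cinner_adj_left[OF assms]
        algebra_simps)
  have form_adj: "cinner (adj A x) x = cnj (cinner (A x) x)" for x
    by (simp add: cinner_adj_left[OF assms] cinner_commute[of x "A x"])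
  have form_R: "cinner (re_part A x) x = Re (cinner (A x) x)" for x
    by (simp add: re_part_def cinner_simps form_adj complex_eq_iff)
  have form_J: "cinner (im_part A x) x = Im (cinner (A x) x)" for x
    by (simp add: im_part_def cinner_simps form_adj complex_eq_iff Re_divide Im_divide)

  define P where "P = (\<lambda>(s::real) x. complex_of_real s *\<^sub>C adj A x + A x)"
  define Q where "Q = (\<lambda>(s::real) x. complex_of_real s *\<^sub>C A x - adj A x)"
  have P: "bounded_linear (P s)" and Q: "bounded_linear (Q s)" for s
    unfolding P_def Q_def
    by (intro bounded_linear_scaleC_comp bounded_linear_add bounded_linear_sub A adj)+
  have form_P: "cinner (P s x) x = s * cnj (cinner (A x) x) + cinner (A x) x"
    and form_Q: "cinner (Q s x) x = s * cinner (A x) x - cnj (cinner (A x) x)" for s x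
    by (simp_all add: P_def Q_def cinner_simps form_adj)
  have P_lower: "(1 + s) * onorm (re_part A) \<le> numerical_radius (P s)"
    and Q_lower: "(1 + s) * onorm (im_part A) \<le> numerical_radius (Q s)"
    and P_upper: "numerical_radius (P s) \<le> (1 + s) * numerical_radius A"
    and Q_upper: "numerical_radius (Q s) \<le> (1 + s) * numerical_radius A"
    if s: "0 \<le> s" "s \<le> 1" for s
  proof -
    note b = cmod_pencil_bounds[OF s]
    \<comment> \<open>As \<open>1 + s\<close> is positive, the pointwise lower bound can be divided
      by it. Self-adjointness then allows passing from the numerical radius to the norm.\<close>
    have "numerical_radius (re_part A) \<le> numerical_radius (P s) / (1 + s)"
    proof (rule numerical_radius_least)
      fix x :: 'a assume "norm x = 1"
      then show "cmod (cinner (re_part A x) x) \<le> numerical_radius (P s) / (1 + s)"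
        using order_trans[OF b(1)[of "cinner (A x) x", folded form_P] numerical_radius_upper[OF P]] s
        by (simp add: form_R field_simps)
    qed (use s numerical_radius_nonneg[OF P] in simp)
    with onorm_le_numerical_radius[OF R R_sa]
    have "onorm (re_part A) \<le> numerical_radius (P s) / (1 + s)" by simp
    then show "(1 + s) * onorm (re_part A) \<le> numerical_radius (P s)"
      using s by (simp add: field_simps)
    have "numerical_radius (im_part A) \<le> numerical_radius (Q s) / (1 + s)"
    proof (rule numerical_radius_least)
      fix x :: 'a assume "norm x = 1"
      then show "cmod (cinner (im_part A x) x) \<le> numerical_radius (Q s) / (1 + s)"
        using order_trans[OF b(3)[of "cinner (A x) x", folded form_Q] numerical_radius_upper[OF Q]] s
        by (simp add: form_J field_simps)
    qed (use s numerical_radius_nonneg[OF Q] in simp)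
    with onorm_le_numerical_radius[OF J J_sa]
    have "onorm (im_part A) \<le> numerical_radius (Q s) / (1 + s)" by simp
    then show "(1 + s) * onorm (im_part A) \<le> numerical_radius (Q s)"
      using s by (simp add: field_simps)
    have up: "(1 + s) * cmod (cinner (A x) x) \<le> (1 + s) * numerical_radius A" if "norm x = 1" for x
      using numerical_radius_upper[OF A that] s by (simp add: mult_left_mono)
    show "numerical_radius (P s) \<le> (1 + s) * numerical_radius A"
         "numerical_radius (Q s) \<le> (1 + s) * numerical_radius A"
      using s numerical_radius_nonneg[OF A]
      by (auto intro!: numerical_radius_least order_trans[OF b(2) up] order_trans[OF b(4) up]
          simp: form_P form_Q)
  qed

  define F where "F = (\<lambda>t::real. numerical_radius (P (1 - 2 * t)) + numerical_radius (Q (1 - 2 * t)))"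
  have F_eq: "F = (\<lambda>t. weighted_numerical_radius t A
      + numerical_radius (\<lambda>x. complex_of_real (1 - 2 * t) *\<^sub>C A x - adj A x))"
    by (simp add: F_def P_def Q_def weighted_numerical_radius_def)
  have cont_P: "continuous_on UNIV (\<lambda>s. numerical_radius (P s))"
    unfolding P_def by (rule continuous_on_numerical_radius_pencil[OF A adj])
  \<comment> \<open>\<open>Q\<close> is the pencil with \<open>A\<close> as the coefficient of
    \<open>s\<close> and \<open>- adj A\<close> as the constant term.\<close>
  have cont_Q: "continuous_on UNIV (\<lambda>s. numerical_radius (Q s))"
    using continuous_on_numerical_radius_pencil[OF bounded_linear_minus[OF adj] A, of UNIV]
    by (simp add: Q_def)
  have "continuous_on {0..1/2} F"
    unfolding F_def
    by (intro continuous_on_add continuous_on_compose2[OF cont_P] continuous_on_compose2[OF cont_Q]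
        continuous_intros) auto
  then have int_F: "(F has_integral integral {0..1/2} F) {0..1/2}"
    by (intro integrable_integral integrable_continuous_interval)
  \<comment> \<open>For \<open>s = 1 - 2 * t\<close> the factor \<open>1 + s\<close> is
    \<open>2 - 2 * t\<close>, with antiderivative \<open>2 * t - t\<^sup>2\<close>.\<close>
  have weight: "((\<lambda>t::real. (2 - 2 * t) * c) has_integral (3/4) * c) {0..1/2}" for c
  proof -
    have "((\<lambda>t::real. (2 - 2 * t) * c) has_integral
        ((2 * (1/2) - (1/2)\<^sup>2) * c - (2 * 0 - 0\<^sup>2) * c)) {0..1/2}"
      by (rule fundamental_theorem_of_calculus)
        (auto intro!: derivative_eq_intros
          simp: has_real_derivative_iff_has_vector_derivative[symmetric])
    then show ?thesis by (simp add: power2_eq_square algebra_simps)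
  qed
  \<comment> \<open>Multiplied by \<open>2 / 3\<close>, the constant \<open>3/4\<close> becomes the
    \<open>1 / 2\<close> of the middle inequality.\<close>
  have "(3/4) * (onorm (re_part A) + onorm (im_part A)) \<le> integral {0..1/2} F"
  proof (rule has_integral_le[OF weight int_F])
    fix t :: real assume "t \<in> {0..1/2}"
    then show "(2 - 2 * t) * (onorm (re_part A) + onorm (im_part A)) \<le> F t"
      using P_lower[of "1 - 2 * t"] Q_lower[of "1 - 2 * t"] by (simp add: F_def distrib_left)
  qed
  \<comment> \<open>The factor \<open>2\<close> counts the two summands of \<open>F\<close>;
    altogether \<open>2 / 3 * (3/4) * 2 = 1\<close>.\<close>
  moreover have "integral {0..1/2} F \<le> (3/4) * (2 * numerical_radius A)"
  proof (rule has_integral_le[OF int_F weight])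
    fix t :: real assume "t \<in> {0..1/2}"
    then show "F t \<le> (2 - 2 * t) * (2 * numerical_radius A)"
      using P_upper[of "1 - 2 * t"] Q_upper[of "1 - 2 * t"] by (simp add: F_def)
  qed
  \<comment> \<open>The first inequality of the chain, doubled: the triangle inequality for the
    Cartesian decomposition of \<open>A\<close>.\<close>
  moreover have "onorm A \<le> onorm (re_part A) + onorm (im_part A)"
  proof (rule onorm_bound)
    show "0 \<le> onorm (re_part A) + onorm (im_part A)"
      by (intro add_nonneg_nonneg onorm_pos_le R J)
    fix x
    have "A x = re_part A x + \<i> *\<^sub>C im_part A x"
    proof -
      have "cinner y (A x) = cinner y (re_part A x + \<i> *\<^sub>C im_part A x)" for y
        by (simp add: re_part_def im_part_def cinner_simps field_simps)
      then show ?thesis by (rule cinner_ext)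
    qed
    then have "norm (A x) \<le> norm (re_part A x) + norm (im_part A x)"
      using norm_triangle_ineq[of "re_part A x" "\<i> *\<^sub>C im_part A x"] by (simp add: norm_scaleC)
    also have "\<dots> \<le> (onorm (re_part A) + onorm (im_part A)) * norm x"
      using onorm[OF R, of x] onorm[OF J, of x] by (simp add: distrib_right)
    finally show "norm (A x) \<le> (onorm (re_part A) + onorm (im_part A)) * norm x" .
  qed
  ultimately show ?thesis
    unfolding F_eq[symmetric] by argo
qed

end
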